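(* Let $w:2^{[n]}\to L$ be a nondecreasing set function that is cardinality-based, so that $w(S)=m(|S|)$ for all $S\subseteq[n]$ for some nondecreasing function $m:\{0,1,\ldots,n\}\to L$. Let $X_1,\ldots,X_n$ be (generally dependent) $L$-valued random variables on a common probability space, let $Y=p_w(X_1,\ldots,X_n)$ and let $F_Y(y)=\Pr(Y\leqslant y)$. For $y\in L$, let $s(y)$ be the smallest $s\in\{0,\ldots,n\}$ with $m(s)>y$ if such an $s$ exists, and $s(y)=n+1$ otherwise. Then, for any $y\in L$, $$1-F_Y(y)=\sum_{s=s(y)}^n\Pr(|\vec\chi(y)|=s)$$ (where an empty sum is $0$).
   Context: $[n]=\{1,\ldots,n\}$. $L\subseteq[-\infty,\infty]$ is a (totally ordered) bounded lattice with bottom element $a$ and top element $b$; $\wedge$ and $\vee$ denote min and max, empty meets equal $b$. For a nondecreasing set function $w:2^{[n]}\to L$ (i.e. $S\subseteq T$ implies $w(S)\leqslant w(T)$), $p_w:L^n\to L$ is the weighted lattice polynomial $p_w(\vec x)=\bigvee_{S\subseteq[n]}\big[w(S)\wedge\bigwedge_{i\in S}x_i\big]$. A set function $w$ is cardinality-based if $|S|=|S'|$ implies $w(S)=w(S')$. $\vec\chi(y)=(\chi_1(y),\ldots,\chi_n(y))$ where $\chi_i(y)\in\{0,1\}$ is the indicator of the event $X_i>y$. For $\vec\kappa\in\{0,1\}^n$, $|\vec\kappa|=\sum_{i=1}^n\kappa_i$. *)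

theory Defs
  imports "HOL-Probability.Probability"
begin

text \<open>
  Vectors in \<open>L\<^sup>n\<close>, with \<open>L\<close> a set of extended reals, are functions on \<^typ>\<open>nat\<close> of which
  only the values at the indices \<open>{1..n}\<close> are used; set functions on \<open>2\<^bsup>[n]\<^esup>\<close> are only used on
  \<open>Pow {1..n}\<close>. Since \<open>L\<close> is a subset of a chain, joins and meets of finite nonempty families
  are maxima and minima.
\<close>

definition cardinality_based :: "nat \<Rightarrow> (nat set \<Rightarrow> ereal) \<Rightarrow> bool" where
  "cardinality_based n w \<longleftrightarrow>
     (\<forall>S \<in> Pow {1..n}. \<forall>S' \<in> Pow {1..n}. card S = card S' \<longrightarrow> w S = w S')"

text \<open>The empty meet is the top element \<open>b\<close> of \<open>L\<close>, which need not be \<^term>\<open>\<infinity> :: ereal\<close>.\<close>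

definition meet_over :: "ereal \<Rightarrow> nat set \<Rightarrow> (nat \<Rightarrow> ereal) \<Rightarrow> ereal" where
  "meet_over b S x = (if S = {} then b else Min (x ` S))"

definition weighted_lattice_poly ::
    "nat \<Rightarrow> ereal \<Rightarrow> (nat set \<Rightarrow> ereal) \<Rightarrow> (nat \<Rightarrow> ereal) \<Rightarrow> ereal" where
  "weighted_lattice_poly n b w x = Max ((\<lambda>S. min (w S) (meet_over b S x)) ` Pow {1..n})"

definition distribution_fun :: "'a measure \<Rightarrow> ('a \<Rightarrow> ereal) \<Rightarrow> ereal \<Rightarrow> real" where
  "distribution_fun M Y y = \<P>(\<omega> in M. Y \<omega> \<le> y)"

definition chi :: "(nat \<Rightarrow> 'a \<Rightarrow> ereal) \<Rightarrow> ereal \<Rightarrow> 'a \<Rightarrow> nat \<Rightarrow> nat" where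
  "chi X y \<omega> i = (if X i \<omega> > y then 1 else 0)"

definition weight :: "nat \<Rightarrow> (nat \<Rightarrow> nat) \<Rightarrow> nat" where
  "weight n \<kappa> = (\<Sum>i = 1..n. \<kappa> i)"

definition first_exceed :: "nat \<Rightarrow> (nat \<Rightarrow> ereal) \<Rightarrow> ereal \<Rightarrow> nat" where
  "first_exceed n m y =
     (if \<exists>s \<le> n. m s > y then (LEAST s. s \<le> n \<and> m s > y) else n + 1)"

end

theory Submission
  imports Defs
begin

text \<open>
  On a chain, a join exceeds \<open>y\<close> as soon as one joinand does, and a meet exceeds \<open>y\<close> only if all
  its members do. Hence \<open>p\<^sub>w x > y\<close> holds iff \<open>w S > y\<close> for some set \<open>S\<close> contained in the
  level set \<open>T\<close> of the indices \<open>i\<close> with \<open>x\<^sub>i > y\<close>. As \<open>w\<close> is monotone, \<open>T\<close> itself is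
  the best such \<open>S\<close>, so the condition is \<open>w T > y\<close>. If moreover \<open>w S = m (card S)\<close>, only
  \<open>card T\<close> matters, and monotonicity of \<open>m\<close> turns \<open>m (card T) > y\<close> into the threshold
  condition \<open>s(y) \<le> card T\<close>.

  For random arguments, \<open>card T\<close> is the number \<open>|\<chi>(y)|\<close> of variables exceeding \<open>y\<close>, so the
  events \<open>Y > y\<close> and \<open>|\<chi>(y)| \<ge> s(y)\<close> coincide. This coincidence is pointwise and so
  indifferent to the joint distribution; it remains to split the second event according to the
  value of \<open>|\<chi>(y)|\<close>.
\<close>

text \<open>
  For \<open>S = {}\<close> the right-hand side is vacuous while the meet is \<open>b\<close>, whence the assumption
  \<open>y < b\<close>. In a joinand with \<open>y < w S\<close> it comes for free from \<open>w S \<le> b\<close>.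
\<close>

lemma less_meet_over_iff:
  assumes "finite S" and "y < b"
  shows "y < meet_over b S x \<longleftrightarrow> (\<forall>i\<in>S. y < x i)"
  using assms by (auto simp: meet_over_def)

lemma less_weighted_lattice_poly_iff:
  assumes mono: "mono_on (Pow {1..n}) w"
    and bound: "\<And>S. S \<subseteq> {1..n} \<Longrightarrow> w S \<le> b"
  shows "y < weighted_lattice_poly n b w x \<longleftrightarrow> y < w {i \<in> {1..n}. y < x i}"
    (is "_ \<longleftrightarrow> y < w ?T")
proof -
  have "y < weighted_lattice_poly n b w x \<longleftrightarrow>
      (\<exists>S\<subseteq>{1..n}. y < w S \<and> y < meet_over b S x)"
    unfolding weighted_lattice_poly_def by (subst Max_gr_iff) auto
  also have "\<dots> \<longleftrightarrow> (\<exists>S\<subseteq>{1..n}. y < w S \<and> (\<forall>i\<in>S. y < x i))"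
  proof -
    have "y < meet_over b S x \<longleftrightarrow> (\<forall>i\<in>S. y < x i)"
      if "S \<subseteq> {1..n}" and "y < w S" for S
      using that bound[of S] finite_subset[of S "{1..n}"]
      by (intro less_meet_over_iff) auto
    then show ?thesis
      by blast
  qed
  also have "\<dots> \<longleftrightarrow> (\<exists>S\<subseteq>?T. y < w S)"
    by blast
  also have "\<dots> \<longleftrightarrow> y < w ?T"
  proof
    assume "\<exists>S\<subseteq>?T. y < w S"
    then obtain S where S: "S \<subseteq> ?T" "y < w S"
      by blast
    then have "w S \<le> w ?T"
      by (intro mono_onD[OF mono]) auto
    with S show "y < w ?T"
      by simp
  qed blast
  finally show ?thesis .
qed

lemma weight_chi_eq_card: "weight n (chi X y \<omega>) = card {i \<in> {1..n}. y < X i \<omega>}"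
  by (simp add: weight_def chi_def sum.If_cases Int_def)

lemma first_exceed_le_iff:
  assumes "mono_on {0..n} m" and "k \<le> n"
  shows "first_exceed n m y \<le> k \<longleftrightarrow> y < m k"
proof
  assume le: "first_exceed n m y \<le> k"
  have ex: "\<exists>s\<le>n. y < m s"
    using le \<open>k \<le> n\<close> by (auto simp: first_exceed_def split: if_splits)
  then have "first_exceed n m y \<le> n \<and> y < m (first_exceed n m y)"
    using LeastI_ex[of "\<lambda>s. s \<le> n \<and> y < m s"] by (simp add: first_exceed_def)
  moreover have "m (first_exceed n m y) \<le> m k"
    using le \<open>k \<le> n\<close> by (intro mono_onD[OF assms(1)]) auto
  ultimately show "y < m k"
    by (blast intro: less_le_trans)
next
  assume "y < m k"
  then show "first_exceed n m y \<le> k"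
    using \<open>k \<le> n\<close> by (auto simp: first_exceed_def intro: Least_le)
qed

lemma measurable_weight_chi:
  assumes "\<And>i. i \<in> {1..n} \<Longrightarrow> X i \<in> borel_measurable M"
  shows "(\<lambda>\<omega>. weight n (chi X y \<omega>)) \<in> measurable M (count_space UNIV)"
  unfolding weight_def chi_def
proof (rule measurable_sum_nat)
  fix i assume "i \<in> {1..n}"
  note assms[OF this, measurable]
  show "(\<lambda>\<omega>. if y < X i \<omega> then 1 else 0 :: nat) \<in> measurable M (count_space UNIV)"
    by measurable
qed

lemma (in prob_space) prob_bounded_nat_ge_eq_sum:
  fixes N :: "'a \<Rightarrow> nat"
  assumes [measurable]: "N \<in> measurable M (count_space UNIV)"
    and bound: "\<And>\<omega>. \<omega> \<in> space M \<Longrightarrow> N \<omega> \<le> n"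
  shows "\<P>(\<omega> in M. k \<le> N \<omega>) = (\<Sum>s = k..n. \<P>(\<omega> in M. N \<omega> = s))"
proof -
  have "{\<omega> \<in> space M. k \<le> N \<omega>} = (\<Union>s\<in>{k..n}. {\<omega> \<in> space M. N \<omega> = s})"
    using bound by auto
  moreover have "prob (\<Union>s\<in>{k..n}. {\<omega> \<in> space M. N \<omega> = s}) =
      (\<Sum>s = k..n. \<P>(\<omega> in M. N \<omega> = s))"
    by (rule finite_measure_finite_Union) (auto simp: disjoint_family_on_def)
  ultimately show ?thesis
    by simp
qed

theorem theorem10:
  fixes L :: "ereal set" and a b y :: ereal and n :: nat
    and w :: "nat set \<Rightarrow> ereal" and m :: "nat \<Rightarrow> ereal"
    and M :: "'a measure" and X :: "nat \<Rightarrow> 'a \<Rightarrow> ereal" and Y :: "'a \<Rightarrow> ereal"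
  assumes "a \<in> L" and "b \<in> L" and "\<And>x. x \<in> L \<Longrightarrow> a \<le> x \<and> x \<le> b"
    and "w \<in> Pow {1..n} \<rightarrow> L"
    and "mono_on (Pow {1..n}) w"
    and "cardinality_based n w"
    and "m \<in> {0..n} \<rightarrow> L"
    and "mono_on {0..n} m"
    and "\<And>S. S \<subseteq> {1..n} \<Longrightarrow> w S = m (card S)"
    and "prob_space M"
    and "\<And>i. i \<in> {1..n} \<Longrightarrow> X i \<in> M \<rightarrow>\<^sub>M restrict_space borel L"
    and "\<And>\<omega>. \<omega> \<in> space M \<Longrightarrow> Y \<omega> = weighted_lattice_poly n b w (\<lambda>i. X i \<omega>)"
    and "y \<in> L"
  shows "1 - distribution_fun M Y y =
           (\<Sum>s = first_exceed n m y..n. \<P>(\<omega> in M. weight n (chi X y \<omega>) = s))"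
proof -
  interpret prob_space M
    by fact
  let ?N = "\<lambda>\<omega>. weight n (chi X y \<omega>)"
  have N_le: "?N \<omega> \<le> n" for \<omega>
  proof -
    have "card {i \<in> {1..n}. y < X i \<omega>} \<le> card {1..n}"
      by (rule card_mono) auto
    then show ?thesis
      unfolding weight_chi_eq_card by simp
  qed
  have N_meas [measurable]: "?N \<in> measurable M (count_space UNIV)"
    using assms(11) by (intro measurable_weight_chi) (auto simp: measurable_restrict_space2_iff)
  have w_le: "w S \<le> b" if "S \<subseteq> {1..n}" for S
    using assms(3,4) that by blast
  have exceeds_iff: "y < Y \<omega> \<longleftrightarrow> first_exceed n m y \<le> ?N \<omega>" if "\<omega> \<in> space M" for \<omega>
  proof -
    have "y < Y \<omega> \<longleftrightarrow> y < w {i \<in> {1..n}. y < X i \<omega>}"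
      unfolding assms(12)[OF that] by (rule less_weighted_lattice_poly_iff[OF assms(5) w_le])
    also have "\<dots> \<longleftrightarrow> y < m (?N \<omega>)"
      unfolding weight_chi_eq_card by (subst assms(9)) auto
    also have "\<dots> \<longleftrightarrow> first_exceed n m y \<le> ?N \<omega>"
      using first_exceed_le_iff[OF assms(8) N_le] by simp
    finally show ?thesis .
  qed
  \<comment> \<open>Passing to the count also provides the measurability of the event \<open>Y \<le> y\<close>.\<close>
  have "{\<omega> \<in> space M. Y \<omega> \<le> y} = {\<omega> \<in> space M. \<not> first_exceed n m y \<le> ?N \<omega>}"
    using exceeds_iff by (auto simp: not_less[symmetric])
  then have "1 - distribution_fun M Y y = 1 - \<P>(\<omega> in M. \<not> first_exceed n m y \<le> ?N \<omega>)"
    by (simp add: distribution_fun_def)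
  also have "\<dots> = \<P>(\<omega> in M. first_exceed n m y \<le> ?N \<omega>)"
    by (subst prob_neg) auto
  also have "\<dots> = (\<Sum>s = first_exceed n m y..n. \<P>(\<omega> in M. ?N \<omega> = s))"
    using N_le by (intro prob_bounded_nat_ge_eq_sum) auto
  finally show ?thesis .
qed

end
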